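(* Let $\mathcal W$ be a non-P-point in standard position on $\omega^2$. Assume $\mathcal W$ has the three-functions property and that $\pi_1$ is a conservative map on $\mathcal W$. Then $\mathcal W$ is $(n,T(n))$-weakly Ramsey for every $n\ge1$.
   Context: Ultrafilters are nonprincipal. A non-P-point in standard position is an ultrafilter $\mathcal W$ on $\omega^2$ such that the first projection $\pi_1$ is neither finite-to-one nor constant on any set in $\mathcal W$. Three-functions property: for every function $f$ on $\omega^2$ there is $H\in\mathcal W$ with $f\restriction H$ constant, one-to-one, or equal to $g\circ\pi_1\restriction H$ with $g$ one-to-one. $(n,t)$-weakly Ramsey: for every partition of $[\omega^2]^n$ into finitely many pieces some $H\in\mathcal W$ has $[H]^n$ meeting at most $t$ pieces. $T(n)$ is the number of $n$-types, where an $n$-type is a linear pre-order of formal symbols $x_1,\dots,x_n,y_1,\dots,y_n$ with $y_1<\dots<y_n$ strictly, each $x_i<y_i$ strictly, and any two distinct equivalent symbols both $x$'s. Conservativity: the language of full arithmetic has a function or relation symbol for every finitary function and relation on $\omega$; $\mathfrak N$ is the standard model on $\omega$. For an ultrafilter $\mathcal D$ on a countable set $S$, $\mathcal D\text{-prod}\,\mathfrak N$ is the ultrapower of $\mathfrak N$ by $\mathcal D$ (functions $S\to\omega$ modulo $\mathcal D$). For $f$ with domain $S$, $f(\mathcal D)=\{B:f^{-1}(B)\in\mathcal D\}$ and $f_*:f(\mathcal D)\text{-prod}\,\mathfrak N\to\mathcal D\text{-prod}\,\mathfrak N$, $[g]\mapsto[g\circ f]$, is an elementary embedding. An elementary extension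 $\mathfrak B$ of $\mathfrak A$ is conservative if for every subset $X$ of $\mathfrak B$ definable with parameters in $\mathfrak B$, $X\cap|\mathfrak A|$ is definable with parameters in $\mathfrak A$. $f$ is a conservative map on $\mathcal D$ if $\mathcal D\text{-prod}\,\mathfrak N$ is a conservative extension of the image of $f_*$. *)

theory Defs
  imports Main
begin

definition ultrafilter :: "'a set set \<Rightarrow> bool" where
  "ultrafilter U \<longleftrightarrow>
     UNIV \<in> U \<and> {} \<notin> U \<and>
     (\<forall>A B. A \<in> U \<and> A \<subseteq> B \<longrightarrow> B \<in> U) \<and>
     (\<forall>A B. A \<in> U \<and> B \<in> U \<longrightarrow> A \<inter> B \<in> U) \<and>
     (\<forall>A. A \<in> U \<or> - A \<in> U)"

definition nonprincipal :: "'a set set \<Rightarrow> bool" where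
  "nonprincipal U \<longleftrightarrow> \<not> (\<exists>a. {a} \<in> U)"

definition finite_to_one_on :: "('a \<Rightarrow> 'b) \<Rightarrow> 'a set \<Rightarrow> bool" where
  "finite_to_one_on f H \<longleftrightarrow> (\<forall>y. finite {x \<in> H. f x = y})"

definition constant_on :: "('a \<Rightarrow> 'b) \<Rightarrow> 'a set \<Rightarrow> bool" where
  "constant_on f H \<longleftrightarrow> (\<exists>c. \<forall>x\<in>H. f x = c)"

definition non_P_point_std :: "(nat \<times> nat) set set \<Rightarrow> bool" where
  "non_P_point_std W \<longleftrightarrow> ultrafilter W \<and> nonprincipal W \<and>
     (\<forall>H\<in>W. \<not> finite_to_one_on fst H \<and> \<not> constant_on fst H)"

definition three_functions_property :: "(nat \<times> nat) set set \<Rightarrow> bool" where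
  "three_functions_property W \<longleftrightarrow>
     (\<forall>f :: nat \<times> nat \<Rightarrow> nat. \<exists>H\<in>W.
        constant_on f H \<or> inj_on f H \<or>
        (\<exists>g :: nat \<Rightarrow> nat. inj g \<and> (\<forall>p\<in>H. f p = g (fst p))))"

definition nsubsets :: "'a set \<Rightarrow> nat \<Rightarrow> 'a set set" where
  "nsubsets H n = {A. A \<subseteq> H \<and> finite A \<and> card A = n}"

text \<open>A partition of [omega^2]^n into finitely many pieces is given by a colouring
  c with values in {..<k}; the pieces are the colour classes.\<close>
definition weakly_Ramsey :: "nat \<Rightarrow> nat \<Rightarrow> (nat \<times> nat) set set \<Rightarrow> bool" where
  "weakly_Ramsey n t W \<longleftrightarrow>
     (\<forall>(c :: (nat \<times> nat) set \<Rightarrow> nat) (k :: nat).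
        c ` nsubsets UNIV n \<subseteq> {..<k} \<longrightarrow>
        (\<exists>H\<in>W. card (c ` nsubsets H n) \<le> t))"

text \<open>Symbols: Inl i stands for x_i, Inr i for y_i, with 1 \<le> i \<le> n.\<close>
definition type_symbols :: "nat \<Rightarrow> (nat + nat) set" where
  "type_symbols n = Inl ` {1..n} \<union> Inr ` {1..n}"

definition strictly_below :: "(nat + nat) rel \<Rightarrow> nat + nat \<Rightarrow> nat + nat \<Rightarrow> bool" where
  "strictly_below R a b \<longleftrightarrow> (a, b) \<in> R \<and> (b, a) \<notin> R"

definition n_types :: "nat \<Rightarrow> (nat + nat) rel set" where
  "n_types n = {R. R \<subseteq> type_symbols n \<times> type_symbols n \<and>
      preorder_on (type_symbols n) R \<and> total_on (type_symbols n) R \<and>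
      (\<forall>i j. 1 \<le> i \<and> i < j \<and> j \<le> n \<longrightarrow> strictly_below R (Inr i) (Inr j)) \<and>
      (\<forall>i. 1 \<le> i \<and> i \<le> n \<longrightarrow> strictly_below R (Inl i) (Inr i)) \<and>
      (\<forall>a\<in>type_symbols n. \<forall>b\<in>type_symbols n.
          a \<noteq> b \<and> (a, b) \<in> R \<and> (b, a) \<in> R \<longrightarrow> isl a \<and> isl b)}"

definition T :: "nat \<Rightarrow> nat" where
  "T n = card (n_types n)"

text \<open>Language of full arithmetic: a function symbol for every finitary function on
  nat and a relation symbol for every finitary relation on nat (a symbol applied to
  a list of k arguments denotes its k-ary instance).\<close>
datatype fa_term = Var nat | Fn "nat list \<Rightarrow> nat" "fa_term list"

datatype fa_form =
    Eq fa_term fa_term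
  | Rel "nat list \<Rightarrow> bool" "fa_term list"
  | Neg fa_form
  | Conj fa_form fa_form
  | Ex nat fa_form

fun tval :: "(nat \<Rightarrow> 's \<Rightarrow> nat) \<Rightarrow> 's \<Rightarrow> fa_term \<Rightarrow> nat" where
  "tval e s (Var i) = e i s"
| "tval e s (Fn F ts) = F (map (tval e s) ts)"

text \<open>Satisfaction in the ultrapower D-prod N (or in its substructure whose elements are
  the classes of the functions in U, U being closed under the pointwise operations).
  Elements are represented by functions S \<Rightarrow> nat; equality is equality modulo D.\<close>
fun usat :: "'s set set \<Rightarrow> ('s \<Rightarrow> nat) set \<Rightarrow> (nat \<Rightarrow> 's \<Rightarrow> nat) \<Rightarrow> fa_form \<Rightarrow> bool" where
  "usat D U e (Eq t u) \<longleftrightarrow> {s. tval e s t = tval e s u} \<in> D"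
| "usat D U e (Rel R ts) \<longleftrightarrow> {s. R (map (tval e s) ts)} \<in> D"
| "usat D U e (Neg \<phi>) \<longleftrightarrow> \<not> usat D U e \<phi>"
| "usat D U e (Conj \<phi> \<psi>) \<longleftrightarrow> usat D U e \<phi> \<and> usat D U e \<psi>"
| "usat D U e (Ex x \<phi>) \<longleftrightarrow> (\<exists>g\<in>U. usat D U (e(x := g)) \<phi>)"

text \<open>Image of f_* : f(D)-prod N \<rightarrow> D-prod N, [g] \<mapsto> [g \<circ> f].\<close>
definition pushforward_image :: "('s \<Rightarrow> 't) \<Rightarrow> ('s \<Rightarrow> nat) set" where
  "pushforward_image f = {g \<circ> f | g :: 't \<Rightarrow> nat. True}"

text \<open>D-prod N is a conservative extension of the image of f_*: for every set X definable
  in D-prod N (by formula phi in free variable v, with parameters e), X intersected with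
  the image is definable in the image (by psi in variable w with parameters e' from the
  image).\<close>
definition conservative_map :: "('s \<Rightarrow> 't) \<Rightarrow> 's set set \<Rightarrow> bool" where
  "conservative_map f D \<longleftrightarrow>
     (\<forall>\<phi> v (e :: nat \<Rightarrow> 's \<Rightarrow> nat). \<exists>\<psi> w (e' :: nat \<Rightarrow> 's \<Rightarrow> nat).
        (\<forall>i. e' i \<in> pushforward_image f) \<and>
        (\<forall>h\<in>pushforward_image f.
           usat D UNIV (e(v := h)) \<phi> \<longleftrightarrow> usat D (pushforward_image f) (e'(w := h)) \<psi>))"

end

(* Conservativity says that a family of sets indexed by W agrees, on all functions that factor
   through the first projection, with a family indexed by fst(W). By the three-functions property
   the least point of disagreement is then one-to-one on a set in W. On a sufficiently sparse set
   in W, membership of a tuple of coordinates in a given set C is therefore decided without its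
   largest coordinate, by a set of shorter tuples. Iterating this gives, for each n-type, a set
   in W whose n-subsets of that type all have the same colour. *)

theory Submission
  imports Defs "HOL-Library.FuncSet" "HOL-Library.Nat_Bijection"
begin

section \<open>Ultrafilters and the theorem of Los\<close>

text \<open>The difficulty lies in a largest coordinate y_i. A largest value taken by x's alone is
  removed by a plain limit of sets along \<open>W\<close>: that limit is right at each fixed number,
  so the least disagreement is a one-to-one function of the removed value and grows with it. For y_i
  such a limit could go wrong at a number g(x_i), and a disagreement controlled by x_i alone gives
  no bound in terms of y_i. Conservativity supplies a replacement that may depend on x_i and is
  right at every g(x_i). This dependence is harmless: x_i is smaller than y_i, so it is still
  present in the shorter tuple.

  In both cases the replacement is correct up to m once the removed value exceeds some
  \<open>h m\<close>. Shorter tuples are coded by numbers, so m has to bound a code. This fixes the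
  sparseness required: each coordinate must exceed a function, computed from \<open>h\<close> and
  the coding, of the next smaller one.\<close>

lemma ultrafilter_superset: "\<lbrakk>ultrafilter U; A \<in> U; A \<subseteq> B\<rbrakk> \<Longrightarrow> B \<in> U"
  unfolding ultrafilter_def by blast

lemma ultrafilter_Int: "\<lbrakk>ultrafilter U; A \<in> U; B \<in> U\<rbrakk> \<Longrightarrow> A \<inter> B \<in> U"
  unfolding ultrafilter_def by blast

lemma ultrafilter_nonempty: "\<lbrakk>ultrafilter U; A \<in> U\<rbrakk> \<Longrightarrow> \<exists>x. x \<in> A"
  unfolding ultrafilter_def by blast

lemma ultrafilter_Compl_iff: "ultrafilter U \<Longrightarrow> - A \<in> U \<longleftrightarrow> A \<notin> U"
  unfolding ultrafilter_def by (metis Compl_disjoint)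

lemma ultrafilter_Int_iff: "ultrafilter U \<Longrightarrow> A \<inter> B \<in> U \<longleftrightarrow> A \<in> U \<and> B \<in> U"
  unfolding ultrafilter_def by (meson inf_le1 inf_le2)

lemma ultrafilter_INT:
  assumes "ultrafilter U" "finite I" "\<And>i. i \<in> I \<Longrightarrow> F i \<in> U"
  shows "(\<Inter>i\<in>I. F i) \<in> U"
  using assms(2,3)
proof (induction I rule: finite_induct)
  case empty
  then show ?case using assms(1) by (simp add: ultrafilter_def)
next
  case (insert i I)
  then show ?case by (simp add: ultrafilter_Int[OF assms(1)])
qed

lemma ultrafilter_agree:
  assumes "ultrafilter U" and "{s. P s} \<in> U \<longleftrightarrow> {s. Q s} \<in> U"
  shows "{s. P s \<longleftrightarrow> Q s} \<in> U"
proof (cases "{s. P s} \<in> U")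
  case True
  then have "{s. P s} \<inter> {s. Q s} \<in> U"
    using assms by (simp add: ultrafilter_Int)
  then show ?thesis
    by (rule ultrafilter_superset[OF assms(1)]) auto
next
  case False
  then have "- {s. P s} \<inter> - {s. Q s} \<in> U"
    using assms by (simp add: ultrafilter_Int ultrafilter_Compl_iff)
  then show ?thesis
    by (rule ultrafilter_superset[OF assms(1)]) auto
qed

fun term_value :: "(nat \<Rightarrow> nat) \<Rightarrow> fa_term \<Rightarrow> nat" where
  "term_value e (Var i) = e i"
| "term_value e (Fn F ts) = F (map (term_value e) ts)"

fun std_sat :: "(nat \<Rightarrow> nat) \<Rightarrow> fa_form \<Rightarrow> bool" where
  "std_sat e (Eq t u) \<longleftrightarrow> term_value e t = term_value e u"
| "std_sat e (Rel R ts) \<longleftrightarrow> R (map (term_value e) ts)"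
| "std_sat e (Neg \<phi>) \<longleftrightarrow> \<not> std_sat e \<phi>"
| "std_sat e (Conj \<phi> \<psi>) \<longleftrightarrow> std_sat e \<phi> \<and> std_sat e \<psi>"
| "std_sat e (Ex x \<phi>) \<longleftrightarrow> (\<exists>n. std_sat (e(x := n)) \<phi>)"

lemma tval_eq_term_value: "tval e s t = term_value (\<lambda>i. e i s) t"
proof (induction t)
  case (Fn F ts)
  then have "map (tval e s) ts = map (term_value (\<lambda>i. e i s)) ts" by simp
  then show ?case by (metis tval.simps(2) term_value.simps(2))
qed simp

lemma map_tval_eq: "map (tval e s) ts = map (term_value (\<lambda>i. e i s)) ts"
  by (simp add: tval_eq_term_value)

lemma upd_eval: "(\<lambda>i. (e(x := g)) i s) = (\<lambda>i. e i s)(x := g s)"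
  by auto

text \<open>The existential step works inside the substructure because parameters that factor
  through \<open>f\<close> depend on \<open>s\<close> only via \<open>f s\<close>; a witness can be
  chosen at \<open>f s\<close>, and so factors through \<open>f\<close> again. The quantified case
  is needed since conservativity returns an unknown formula.\<close>

lemma Los_pushforward_image:
  assumes U: "ultrafilter D" and "\<And>i. e i \<in> pushforward_image f"
  shows "usat D (pushforward_image f) e \<phi> \<longleftrightarrow> {s. std_sat (\<lambda>i. e i s) \<phi>} \<in> D"
  using assms(2)
proof (induction \<phi> arbitrary: e)
  case (Eq t u)
  then show ?case by (simp add: tval_eq_term_value)
next
  case (Rel R ts)
  then show ?case by (simp only: usat.simps std_sat.simps map_tval_eq)
next
  case (Neg \<phi>)
  have "{s. \<not> std_sat (\<lambda>i. e i s) \<phi>} = - {s. std_sat (\<lambda>i. e i s) \<phi>}" by auto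
  with Neg show ?case by (simp add: ultrafilter_Compl_iff[OF U])
next
  case (Conj \<phi> \<psi>)
  have "{s. std_sat (\<lambda>i. e i s) \<phi> \<and> std_sat (\<lambda>i. e i s) \<psi>}
      = {s. std_sat (\<lambda>i. e i s) \<phi>} \<inter> {s. std_sat (\<lambda>i. e i s) \<psi>}" by auto
  with Conj show ?case by (simp add: ultrafilter_Int_iff[OF U])
next
  case (Ex x \<phi>)
  have IH: "usat D (pushforward_image f) (e(x := g)) \<phi>
      \<longleftrightarrow> {s. std_sat ((\<lambda>i. e i s)(x := g s)) \<phi>} \<in> D"
    if "g \<in> pushforward_image f" for g
  proof -
    have "(e(x := g)) i \<in> pushforward_image f" for i using Ex.prems that by simp
    from Ex.IH[of "e(x := g)", OF this] show ?thesis unfolding upd_eval .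
  qed
  have "\<forall>i. \<exists>g. e i = g \<circ> f"
    using Ex.prems by (auto simp: pushforward_image_def)
  then obtain E where E: "\<And>i. e i = E i \<circ> f" by metis
  define G where "G t = (SOME n. std_sat ((\<lambda>i. E i t)(x := n)) \<phi>)" for t
  have G: "std_sat ((\<lambda>i. e i s)(x := (G \<circ> f) s)) \<phi>"
    if "std_sat ((\<lambda>i. e i s)(x := n)) \<phi>" for s n
    using that unfolding G_def E comp_def by (rule someI)
  have "G \<circ> f \<in> pushforward_image f" by (auto simp: pushforward_image_def)
  then show ?case
    using G by (auto simp: IH intro: ultrafilter_superset[OF U] intro!: bexI[of _ "G \<circ> f"])
qed

text \<open>Conservativity in combinatorial form: a \<open>D\<close>-indexed family of sets is matched, on all
  functions that factor through \<open>f\<close>, by an \<open>f(D)\<close>-indexed family.\<close>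

lemma conservative_map_family:
  fixes D :: "(nat \<times> nat) set set" and A :: "nat \<times> nat \<Rightarrow> nat set"
  assumes U: "ultrafilter D" and "conservative_map f D"
  shows "\<exists>B. \<forall>g. {p. g (f p) \<in> A p \<longleftrightarrow> g (f p) \<in> B (f p)} \<in> D"
proof -
  \<comment> \<open>An atomic formula, so its truth in the full ultrapower unfolds directly. The
    parameter at \<open>Var 1\<close> is the identity on pairs, coded as a number; through it the
    whole family \<open>A\<close> becomes one definable set.\<close>
  define \<phi> where "\<phi> = Rel (\<lambda>l. l ! 0 \<in> A (prod_decode (l ! 1))) [Var 0, Var 1]"
  define e :: "nat \<Rightarrow> nat \<times> nat \<Rightarrow> nat" where "e = (\<lambda>_. prod_encode)"
  obtain \<psi> w e' where e': "\<And>i. e' i \<in> pushforward_image f"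
    and sat: "\<And>h. h \<in> pushforward_image f \<Longrightarrow>
      usat D UNIV (e(0 := h)) \<phi> \<longleftrightarrow> usat D (pushforward_image f) (e'(w := h)) \<psi>"
    using assms(2) unfolding conservative_map_def by metis
  have "\<forall>i. \<exists>g. e' i = g \<circ> f"
    using e' by (auto simp: pushforward_image_def)
  then obtain E where E: "\<And>i. e' i = E i \<circ> f" by metis
  \<comment> \<open>The parameters of \<psi> are functions of \<open>f p\<close>, so evaluating them
    at \<open>t\<close> yields a set for each value \<open>t\<close> of \<open>f\<close>.\<close>
  define B where "B t = {z. std_sat ((\<lambda>i. E i t)(w := z)) \<psi>}" for t
  have "{p. g (f p) \<in> A p \<longleftrightarrow> g (f p) \<in> B (f p)} \<in> D" for g
  proof (rule ultrafilter_agree[OF U])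
    have h: "g \<circ> f \<in> pushforward_image f" by (auto simp: pushforward_image_def)
    have "usat D (pushforward_image f) (e'(w := g \<circ> f)) \<psi>
        \<longleftrightarrow> {s. std_sat ((\<lambda>i. e' i s)(w := (g \<circ> f) s)) \<psi>} \<in> D"
    proof -
      have "(e'(w := g \<circ> f)) i \<in> pushforward_image f" for i using e' h by simp
      from Los_pushforward_image[OF U, of "e'(w := g \<circ> f)", OF this] show ?thesis unfolding upd_eval .
    qed
    with sat[OF h] show "{p. g (f p) \<in> A p} \<in> D \<longleftrightarrow> {p. g (f p) \<in> B (f p)} \<in> D"
      by (simp add: \<phi>_def e_def B_def E)
  qed
  then show ?thesis by blast
qed

section \<open>What the first projection excludes on sets in the ultrafilter\<close>

locale three_functions_ultrafilter =
  fixes W :: "(nat \<times> nat) set set"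
  assumes std: "non_P_point_std W"
    and three: "three_functions_property W"
begin

lemma U: "ultrafilter W"
  using std by (simp add: non_P_point_std_def)

lemma superset: "\<lbrakk>A \<in> W; A \<subseteq> B\<rbrakk> \<Longrightarrow> B \<in> W"
  using ultrafilter_superset[OF U] .

lemma Int: "\<lbrakk>A \<in> W; B \<in> W\<rbrakk> \<Longrightarrow> A \<inter> B \<in> W"
  using ultrafilter_Int[OF U] .

lemma not_finite_to_one: "H \<in> W \<Longrightarrow> \<not> finite_to_one_on fst H"
  using std by (simp add: non_P_point_std_def)

lemma not_inj_on_fst:
  assumes "H \<in> W" "inj_on (\<lambda>p. f (fst p)) H" shows False
proof -
  have "finite {p \<in> H. fst p = x}" for x
  proof (cases "{p \<in> H. fst p = x} = {}")
    case True
    then show ?thesis by (simp only: finite.emptyI)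
  next
    case False
    then obtain q where q: "q \<in> H" "fst q = x" by blast
    then have "{p \<in> H. fst p = x} \<subseteq> {q}"
      using assms(2) by (auto simp: inj_on_def)
    then show ?thesis using finite_subset by blast
  qed
  then show False
    using not_finite_to_one[OF assms(1)] by (simp add: finite_to_one_on_def)
qed

text \<open>Such a bound would make \<open>fst\<close> finite-to-one. It excludes that a
  finite-to-one function of the second coordinate is constant or depends only on the first.\<close>

lemma not_bounded_snd:
  assumes "H \<in> W" "\<And>p. p \<in> H \<Longrightarrow> snd p \<in> F (fst p)" "\<And>x. finite (F x)"
  shows False
proof -
  have "finite {p \<in> H. fst p = x}" for x
  proof (rule finite_subset)
    show "{p \<in> H. fst p = x} \<subseteq> {x} \<times> F x" using assms(2) by force
  qed (simp add: assms(3))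
  then show False
    using not_finite_to_one[OF assms(1)] by (simp add: finite_to_one_on_def)
qed

lemma fst_gt_in: "{p. m < fst p} \<in> W"
proof -
  have single: "{p. fst p \<noteq> x} \<in> W" for x
  proof -
    have "{p. fst p = x} \<notin> W"
      using std by (auto simp: non_P_point_std_def constant_on_def)
    moreover have "{p. fst p \<noteq> x} = - {p :: nat \<times> nat. fst p = x}" by auto
    ultimately show ?thesis by (simp add: ultrafilter_Compl_iff[OF U])
  qed
  have "(\<Inter>x\<in>{..m}. {p. fst p \<noteq> x}) \<in> W"
    by (rule ultrafilter_INT[OF U]) (auto simp: single)
  then show ?thesis by (rule superset) (auto simp: not_le[symmetric])
qed

lemma three_cases:
  fixes f :: "nat \<times> nat \<Rightarrow> nat"
  obtains (const) H c where "H \<in> W" "\<And>p. p \<in> H \<Longrightarrow> f p = c"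
  | (inj) H where "H \<in> W" "inj_on f H"
  | (fst) H g where "H \<in> W" "inj g" "\<And>p. p \<in> H \<Longrightarrow> f p = g (fst p)"
  using three unfolding three_functions_property_def constant_on_def by metis

section \<open>Sparse sets\<close>

text \<open>The guard makes the recursion descend; a number whose \<open>par\<close> is not smaller
  counts as a root.\<close>

fun tree_colour :: "(nat \<Rightarrow> nat) \<Rightarrow> nat \<Rightarrow> bool" where
  "tree_colour par n = (if par n < n then \<not> tree_colour par (par n) else True)"

declare tree_colour.simps [simp del]

text \<open>Joining \<open>k x\<close> to \<open>k y\<close> for all \<open>(x, y)\<close> in a set where \<open>k \<circ> snd\<close> is injective
  and \<open>k x < k y\<close> gives a forest, as every vertex has at most one smaller neighbour. A
  2-colouring of this forest separates the first from the second coordinates.\<close>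

lemma separated_blocks:
  fixes k :: "nat \<Rightarrow> nat"
  assumes fin_le: "\<And>m. finite {v. k v \<le> m}"
  obtains H where "H \<in> W" "inj_on (\<lambda>p. k (snd p)) H" "inj_on k (fst ` H)"
    "\<And>p q. \<lbrakk>p \<in> H; q \<in> H\<rbrakk> \<Longrightarrow> k (fst p) \<noteq> k (snd q)"
    "\<And>p. p \<in> H \<Longrightarrow> k (fst p) < k (snd p)"
proof -
  have fin: "finite {v. k v = m}" for m
    by (rule finite_subset[OF _ fin_le[of m]]) auto
  obtain H1 where H1: "H1 \<in> W" "inj_on (\<lambda>p. k (snd p)) H1"
  proof (cases rule: three_cases[of "\<lambda>p. k (snd p)"])
    case (const H c)
    then show ?thesis using not_bounded_snd[of H "\<lambda>_. {v. k v = c}"] fin by auto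
  next
    case (fst H g)
    then show ?thesis using not_bounded_snd[of H "\<lambda>x. {v. k v = g x}"] fin by auto
  qed
  obtain H2 where H2: "H2 \<in> W" "inj_on k (fst ` H2)"
  proof (cases rule: three_cases[of "\<lambda>p. k (fst p)"])
    case (const H c)
    obtain m where m: "\<And>v. k v = c \<Longrightarrow> v \<le> m"
      using fin[of c] finite_nat_set_iff_bounded_le by auto
    obtain p where "p \<in> H \<inter> {p. m < fst p}"
      using ultrafilter_nonempty[OF U Int[OF const(1) fst_gt_in]] by blast
    then show ?thesis using const(2)[of p] m[of "fst p"] by auto
  next
    case (inj H)
    then show ?thesis using not_inj_on_fst by blast
  next
    case (fst H g)
    have "inj_on k (fst ` H)"
      by (rule inj_onI) (use fst(2,3) in \<open>auto simp: inj_eq\<close>)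
    with fst(1) show ?thesis using that by blast
  qed
  define H3 where "H3 = {p. k (fst p) < k (snd p)}"
  have H3: "H3 \<in> W"
  proof (rule ccontr)
    assume "H3 \<notin> W"
    then have "- H3 \<in> W" by (simp add: ultrafilter_Compl_iff[OF U])
    then show False
      by (rule not_bounded_snd[of _ "\<lambda>x. {v. k v \<le> k x}"]) (auto simp: H3_def fin_le)
  qed
  \<comment> \<open>At \<open>k (snd p)\<close> with \<open>p\<close> in \<open>H1\<close> this is
    the vertex joined to it. Elsewhere the value is arbitrary, which is harmless: colours are
    compared only along edges coming from \<open>H\<close>.\<close>
  define par where "par n = k (fst (inv_into H1 (\<lambda>p. k (snd p)) n))" for n
  have par: "par (k (snd p)) = k (fst p)" if "p \<in> H1" for p
    using inv_into_f_f[OF H1(2) that] by (simp add: par_def)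
  define S :: "(nat \<times> nat) set" where "S = {p. tree_colour par (k (fst p))}"
  \<comment> \<open>The ultrafilter decides the colour of the first coordinates; the second ones
    then all carry the other colour.\<close>
  define H4 where "H4 = (if S \<in> W then S else - S)"
  have H4: "H4 \<in> W" by (auto simp: H4_def ultrafilter_Compl_iff[OF U])
  define H where "H = H1 \<inter> H2 \<inter> H3 \<inter> H4"
  have col: "tree_colour par (k (snd p)) \<longleftrightarrow> \<not> tree_colour par (k (fst p))"
    if "p \<in> H" for p
    using that par[of p] tree_colour.simps[of par "k (snd p)"] by (auto simp: H_def H3_def)
  have const: "tree_colour par (k (fst p)) \<longleftrightarrow> S \<in> W" if "p \<in> H" for p
    using that by (auto simp: H_def H4_def S_def split: if_splits)
  show ?thesis
  proof (rule that)
    show "H \<in> W" unfolding H_def using H1 H2 H3 H4 by (intro Int)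
    show "inj_on (\<lambda>p. k (snd p)) H" using H1(2) by (rule inj_on_subset) (auto simp: H_def)
    show "inj_on k (fst ` H)" using H2(2) by (rule inj_on_subset) (auto simp: H_def)
    show "k (fst p) \<noteq> k (snd q)" if "p \<in> H" "q \<in> H" for p q
      using col[OF that(2)] const[OF that(1)] const[OF that(2)] by auto
    show "k (fst p) < k (snd p)" if "p \<in> H" for p using that by (auto simp: H_def H3_def)
  qed
qed

lemma separated_imp_eq:
  assumes "inj_on (\<lambda>p. k (snd p)) H" "inj_on k (fst ` H)"
    and "\<And>p q. \<lbrakk>p \<in> H; q \<in> H\<rbrakk> \<Longrightarrow> k (fst p) \<noteq> k (snd q)"
    and "k u = k v" "u \<in> fst ` H \<union> snd ` H" "v \<in> fst ` H \<union> snd ` H"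
  shows "u = v"
  using assms(5,6)
proof (elim UnE)
  assume "u \<in> fst ` H" "v \<in> fst ` H"
  then show ?thesis using inj_onD[OF assms(2,4)] by blast
next
  assume "u \<in> snd ` H" "v \<in> snd ` H"
  then show ?thesis using inj_onD[OF assms(1)] assms(4) by blast
next
  assume "u \<in> fst ` H" "v \<in> snd ` H"
  then show ?thesis using assms(3,4) by (elim imageE) simp
next
  assume "u \<in> snd ` H" "v \<in> fst ` H"
  then show ?thesis using assms(3) assms(4)[symmetric] by (elim imageE) simp
qed

text \<open>Lying in different blocks still allows adjacent blocks. Consecutive numbers share a pair
  in exactly one of the two pairings {2i, 2i+1} and {2i-1, 2i}, so separation in both pairings
  leaves a whole block in between.\<close>

lemma half_separated_less:
  fixes k l :: nat
  assumes "k \<le> l" "k div 2 \<noteq> l div 2" "Suc k div 2 \<noteq> Suc l div 2"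
  shows "Suc k < l"
proof (rule ccontr)
  assume "\<not> Suc k < l"
  then have "l = Suc k" using assms by (cases "l = k") auto
  with assms show False by (cases "even k") auto
qed

lemma sparse_set:
  fixes h :: "nat \<Rightarrow> nat"
  obtains H where "H \<in> W" "inj_on snd H" "\<And>p. p \<in> H \<Longrightarrow> fst p < snd p"
    "\<And>p q. \<lbrakk>p \<in> H; q \<in> H\<rbrakk> \<Longrightarrow> fst p \<noteq> snd q"
    "\<And>u v. \<lbrakk>u \<in> insert 0 (fst ` H \<union> snd ` H); v \<in> fst ` H \<union> snd ` H; u < v\<rbrakk> \<Longrightarrow> h u < v"
    "\<And>v. v \<in> fst ` H \<union> snd ` H \<Longrightarrow> 0 < v"
proof -
  \<comment> \<open>The sum stands in for a maximum of \<open>h\<close> on {0..n}; the added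
    \<open>n\<close> and \<open>Suc\<close> make the iterates strictly increase.\<close>
  define hh where "hh n = Suc (n + sum h {..n})" for n
  have hh_gt: "h j < hh n" if "j \<le> n" for j n
    using member_le_sum[of j "{..n}" h] that by (auto simp: hh_def)
  define a where "a i = (hh ^^ i) 0" for i
  have a_Suc: "a (Suc i) = hh (a i)" and a0: "a 0 = 0" for i by (simp_all add: a_def)
  have a_mono: "strict_mono a"
    unfolding strict_mono_Suc_iff by (simp add: a_Suc hh_def)
  have a_ge: "i \<le> a i" for i using a_mono strict_mono_imp_increasing by blast
  \<comment> \<open>Index of the block [\<open>a i\<close>, \<open>a (Suc i)\<close>) containing
    \<open>v\<close>. A full block between \<open>u\<close> and \<open>v\<close> forces
    \<open>h u < v\<close>.\<close>
  define K where "K v = (LEAST i. v < a (Suc i))" for v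
  have K_less: "v < a (Suc (K v))" for v
    unfolding K_def by (rule LeastI[of _ v]) (meson a_ge Suc_le_lessD)
  have K_ge: "a (K v) \<le> v" for v
  proof (cases "K v")
    case (Suc i)
    then have "\<not> v < a (Suc i)" unfolding K_def using not_less_Least by (metis lessI)
    then show ?thesis using Suc by simp
  qed (simp add: a0)
  have K_mono: "K u \<le> K v" if "u \<le> v" for u v
    unfolding K_def[of u] by (rule Least_le) (use K_less[of v] that in simp)
  have K_fin: "finite {v. K v \<le> m}" for m
  proof (rule finite_subset)
    show "{v. K v \<le> m} \<subseteq> {..<a (Suc m)}"
    proof clarsimp
      fix v assume "K v \<le> m"
      then have "a (Suc (K v)) \<le> a (Suc m)"
        using a_mono by (simp add: strict_mono_less_eq)
      with K_less[of v] show "v < a (Suc m)" by simp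
    qed
  qed simp
  have K_gap: "h u < v" if "Suc (K u) < K v" for u v
  proof -
    have "h u < hh (a (Suc (K u)))" using K_less[of u] by (intro hh_gt) simp
    also have "\<dots> = a (Suc (Suc (K u)))" by (simp add: a_Suc)
    also have "\<dots> \<le> a (K v)" using that a_mono by (simp add: strict_mono_less_eq)
    also have "\<dots> \<le> v" by (rule K_ge)
    finally show ?thesis .
  qed
  have K1_fin: "finite {v. K v div 2 \<le> m}" and K2_fin: "finite {v. Suc (K v) div 2 \<le> m}" for m
    by (rule finite_subset[OF _ K_fin[of "2 * m + 1"]], auto)+
  obtain H1 where H1: "H1 \<in> W" "inj_on (\<lambda>p. K (snd p) div 2) H1"
    "inj_on (\<lambda>v. K v div 2) (fst ` H1)"
    "\<And>p q. \<lbrakk>p \<in> H1; q \<in> H1\<rbrakk> \<Longrightarrow> K (fst p) div 2 \<noteq> K (snd q) div 2"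
    "\<And>p. p \<in> H1 \<Longrightarrow> K (fst p) div 2 < K (snd p) div 2"
    using separated_blocks[of "\<lambda>v. K v div 2", OF K1_fin] by blast
  obtain H2 where H2: "H2 \<in> W" "inj_on (\<lambda>p. Suc (K (snd p)) div 2) H2"
    "inj_on (\<lambda>v. Suc (K v) div 2) (fst ` H2)"
    "\<And>p q. \<lbrakk>p \<in> H2; q \<in> H2\<rbrakk> \<Longrightarrow> Suc (K (fst p)) div 2 \<noteq> Suc (K (snd q)) div 2"
    "\<And>p. p \<in> H2 \<Longrightarrow> Suc (K (fst p)) div 2 < Suc (K (snd p)) div 2"
    using separated_blocks[of "\<lambda>v. Suc (K v) div 2", OF K2_fin] by blast
  \<comment> \<open>The last factor serves \<open>u = 0\<close>, which need not be a coordinate of a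
    point of the set.\<close>
  define H where "H = H1 \<inter> H2 \<inter> {p. h 0 < fst p}"
  have lt: "fst p < snd p" if "p \<in> H" for p
    using H1(5)[of p] that K_mono[of "snd p" "fst p"]
    by (metis H_def IntD1 div_le_mono leD not_le_imp_less)
  have sub: "fst ` H \<union> snd ` H \<subseteq> fst ` H1 \<union> snd ` H1" "fst ` H \<union> snd ` H \<subseteq> fst ` H2 \<union> snd ` H2"
    unfolding H_def by blast+
  have eq1: "u = v"
    if "K u div 2 = K v div 2" "u \<in> fst ` H \<union> snd ` H" "v \<in> fst ` H \<union> snd ` H" for u v
    by (rule separated_imp_eq[OF H1(2-4)]) (use that sub in blast)+
  have eq2: "u = v"
    if "Suc (K u) div 2 = Suc (K v) div 2" "u \<in> fst ` H \<union> snd ` H" "v \<in> fst ` H \<union> snd ` H" for u v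
    by (rule separated_imp_eq[OF H2(2-4)]) (use that sub in blast)+
  have "h 0 < fst p \<and> h 0 < snd p" if "p \<in> H" for p
    using that lt[OF that] by (auto simp: H_def)
  then have big: "h 0 < v" if "v \<in> fst ` H \<union> snd ` H" for v
    using that by blast
  show ?thesis
  proof (rule that)
    show "H \<in> W" unfolding H_def using H1(1) H2(1) fst_gt_in by (intro Int)
    show "inj_on snd H"
      using H1(2) by (auto simp: inj_on_def H_def)
    show "fst p < snd p" if "p \<in> H" for p using lt that .
    show "fst p \<noteq> snd q" if "p \<in> H" "q \<in> H" for p q
      using H1(4)[of p q] that by (auto simp: H_def)
    show "0 < v" if "v \<in> fst ` H \<union> snd ` H" for v using big[OF that] by simp
    show "h u < v" if "u \<in> insert 0 (fst ` H \<union> snd ` H)" "v \<in> fst ` H \<union> snd ` H" "u < v" for u v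
    proof (cases "u = 0")
      case False
      then have u: "u \<in> fst ` H \<union> snd ` H" using that by simp
      have "K u div 2 \<noteq> K v div 2" "Suc (K u) div 2 \<noteq> Suc (K v) div 2"
        using eq1[OF _ u that(2)] eq2[OF _ u that(2)] that(3) by blast+
      moreover have "K u \<le> K v" using that by (intro K_mono) simp
      ultimately have "Suc (K u) < K v" using half_separated_less by blast
      then show ?thesis by (rule K_gap)
    qed (use big that in simp)
  qed
qed

section \<open>Removing the largest coordinate\<close>

text \<open>With \<open>B\<close> the limit along \<open>W\<close>, the least disagreement depends
  only on the first coordinate, so it is not one-to-one on a set in \<open>W\<close>; it is not
  constant either, as each single number is eventually decided as in \<open>B\<close>. What remains
  is an injective function of \<open>fst p\<close>, which is at most \<open>m\<close> for finitely
  many values only; \<open>h m\<close> bounds these.\<close>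

lemma eliminate_fst:
  fixes A :: "nat \<Rightarrow> nat set"
  obtains H h B where "H \<in> W"
    "\<And>p m z. \<lbrakk>p \<in> H; h m < fst p; z \<le> m\<rbrakk> \<Longrightarrow> z \<in> A (fst p) \<longleftrightarrow> z \<in> B"
proof -
  define B where "B = {z. {p. z \<in> A (fst p)} \<in> W}"
  have agree: "{p. z \<in> A (fst p) \<longleftrightarrow> z \<in> B} \<in> W" for z
    by (rule ultrafilter_agree[OF U])
      (use U in \<open>auto simp: B_def ultrafilter_def\<close>)
  define bad :: "(nat \<times> nat) set" where "bad = {p. \<exists>z. \<not> (z \<in> A (fst p) \<longleftrightarrow> z \<in> B)}"
  show ?thesis
  proof (cases "bad \<in> W")
    case False
    then have "- bad \<in> W" by (simp add: ultrafilter_Compl_iff[OF U])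
    then show ?thesis by (rule that) (auto simp: bad_def)
  next
    case True
    define f where "f p = (LEAST z. \<not> (z \<in> A (fst p) \<longleftrightarrow> z \<in> B))" for p :: "nat \<times> nat"
    have f: "\<not> (f p \<in> A (fst p) \<longleftrightarrow> f p \<in> B)" if "p \<in> bad" for p
      using that unfolding bad_def f_def mem_Collect_eq by (rule LeastI_ex)
    have below: "z \<in> A (fst p) \<longleftrightarrow> z \<in> B" if "z < f p" for z p
      using that not_less_Least unfolding f_def by blast
    show ?thesis
    proof (cases rule: three_cases[of f])
      case (const H c)
      obtain p where "p \<in> bad \<inter> H \<inter> {p. c \<in> A (fst p) \<longleftrightarrow> c \<in> B}"
        using ultrafilter_nonempty[OF U Int[OF Int[OF True const(1)] agree]] by blast
      then show ?thesis using f[of p] const(2)[of p] by auto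
    next
      case (inj H)
      then have "inj_on (\<lambda>p. (\<lambda>x. LEAST z. \<not> (z \<in> A x \<longleftrightarrow> z \<in> B)) (fst p)) H"
        unfolding f_def by simp
      then show ?thesis by (rule not_inj_on_fst[OF inj(1), THEN FalseE])
    next
      case (fst H g)
      have "finite {x. g x \<le> m}" for m
        using finite_vimageI[OF finite_atMost fst(2), of m] by (simp add: vimage_def)
      then have "\<forall>m. \<exists>b. \<forall>x. g x \<le> m \<longrightarrow> x \<le> b"
        using finite_nat_set_iff_bounded_le by simp
      then obtain h where h: "\<And>m x. g x \<le> m \<Longrightarrow> x \<le> h m" by metis
      show ?thesis
      proof (rule that[OF fst(1)])
        fix p m z assume "p \<in> H" "h m < fst p" "z \<le> m"
        then have "z < f p" using fst(3)[of p] h[of "fst p" m] by force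
        then show "z \<in> A (fst p) \<longleftrightarrow> z \<in> B" by (rule below)
      qed
    qed
  qed
qed

text \<open>Agreement at every \<open>g (fst p)\<close> excludes a least disagreement that is
  constant or a function of \<open>fst p\<close>. In the one-to-one case only finitely many points
  of \<open>H\<close> have a disagreement at or below \<open>m\<close>, and \<open>h m\<close>
  bounds their second coordinates.\<close>

lemma eliminate_snd:
  fixes A :: "nat \<times> nat \<Rightarrow> nat set"
  assumes "conservative_map fst W"
  obtains H h B where "H \<in> W"
    "\<And>p m z. \<lbrakk>p \<in> H; h m < snd p; z \<le> m\<rbrakk> \<Longrightarrow> z \<in> A p \<longleftrightarrow> z \<in> B (fst p)"
proof -
  obtain B where agree: "\<And>g. {p. g (fst p) \<in> A p \<longleftrightarrow> g (fst p) \<in> B (fst p)} \<in> W"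
    using conservative_map_family[OF U assms] by metis
  define bad where "bad = {p. \<exists>z. \<not> (z \<in> A p \<longleftrightarrow> z \<in> B (fst p))}"
  show ?thesis
  proof (cases "bad \<in> W")
    case False
    then have "- bad \<in> W" by (simp add: ultrafilter_Compl_iff[OF U])
    then show ?thesis by (rule that) (auto simp: bad_def)
  next
    case True
    define f where "f p = (LEAST z. \<not> (z \<in> A p \<longleftrightarrow> z \<in> B (fst p)))" for p
    have f: "\<not> (f p \<in> A p \<longleftrightarrow> f p \<in> B (fst p))" if "p \<in> bad" for p
      using that unfolding bad_def f_def mem_Collect_eq by (rule LeastI_ex)
    have below: "z \<in> A p \<longleftrightarrow> z \<in> B (fst p)" if "z < f p" for z p
      using that not_less_Least unfolding f_def by blast
    have no_fst: False if H: "H \<in> W" and eq: "\<And>p. p \<in> H \<Longrightarrow> f p = g (fst p)" for H g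
    proof -
      obtain p where "p \<in> bad \<inter> H \<inter> {p. g (fst p) \<in> A p \<longleftrightarrow> g (fst p) \<in> B (fst p)}"
        using ultrafilter_nonempty[OF U Int[OF Int[OF True H] agree]] by blast
      then show False using f[of p] eq[of p] by auto
    qed
    show ?thesis
    proof (cases rule: three_cases[of f])
      case (const H c)
      then show ?thesis using no_fst[of H "\<lambda>_. c"] by blast
    next
      case (fst H g)
      then show ?thesis using no_fst[of H g] by blast
    next
      case (inj H)
      have "finite {p \<in> H. f p \<le> m}" for m
        using finite_vimage_IntI[OF finite_atMost inj(2), of m]
        by (rule back_subst[of finite]) auto
      then have "finite (snd ` {p \<in> H. f p \<le> m})" for m by simp
      then have "\<forall>m. \<exists>b. \<forall>p\<in>H. f p \<le> m \<longrightarrow> snd p \<le> b"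
        unfolding finite_nat_set_iff_bounded_le by (metis (mono_tags, lifting) imageI mem_Collect_eq)
      then obtain h where h: "\<And>m p. \<lbrakk>p \<in> H; f p \<le> m\<rbrakk> \<Longrightarrow> snd p \<le> h m" by metis
      show ?thesis
      proof (rule that[OF inj(1)])
        fix p m z assume "p \<in> H" "h m < snd p" "z \<le> m"
        then have "z < f p" using h[of p m] by force
        then show "z \<in> A p \<longleftrightarrow> z \<in> B (fst p)" by (rule below)
      qed
    qed
  qed
qed

end

section \<open>Homogeneous sets for a fixed type\<close>

text \<open>The reference valuation \<open>z\<^sub>0\<close> only serves to prescribe the order type.\<close>

definition realizes ::
  "(nat \<times> nat) set \<Rightarrow> (nat + nat) set \<Rightarrow> (nat + nat \<Rightarrow> nat) \<Rightarrow> (nat + nat \<Rightarrow> nat) \<Rightarrow> bool" where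
  "realizes H S z\<^sub>0 z \<longleftrightarrow> z \<in> S \<rightarrow>\<^sub>E UNIV \<and>
     (\<forall>a\<in>S. \<forall>b\<in>S. z a \<le> z b \<longleftrightarrow> z\<^sub>0 a \<le> z\<^sub>0 b) \<and>
     (\<forall>i. Inl i \<in> S \<longrightarrow> z (Inl i) \<in> fst ` H) \<and>
     (\<forall>i. Inr i \<in> S \<longrightarrow> Inl i \<in> S \<and> (z (Inl i), z (Inr i)) \<in> H)"

lemma realizes_mono: "\<lbrakk>realizes H S z\<^sub>0 z; H \<subseteq> H'\<rbrakk> \<Longrightarrow> realizes H' S z\<^sub>0 z"
  unfolding realizes_def by blast

lemma realizes_restrict:
  assumes "realizes H S z\<^sub>0 z" "S' \<subseteq> S" "\<And>i. Inr i \<in> S' \<Longrightarrow> Inl i \<in> S'"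
  shows "realizes H S' z\<^sub>0 (restrict z S')"
  using assms unfolding realizes_def by (auto simp: subset_iff)

lemma realizes_value:
  assumes "realizes H S z\<^sub>0 z" "a \<in> S" shows "z a \<in> fst ` H \<union> snd ` H"
proof (cases a)
  case (Inl i)
  then show ?thesis using assms by (simp add: realizes_def)
next
  case (Inr i)
  then have "(z (Inl i), z a) \<in> H" using assms by (simp add: realizes_def)
  then show ?thesis by (metis UnI2 imageI snd_conv)
qed

lemma realizes_less: "\<lbrakk>realizes H S z\<^sub>0 z; a \<in> S; b \<in> S; z\<^sub>0 a < z\<^sub>0 b\<rbrakk> \<Longrightarrow> z a < z b"
  by (simp add: realizes_def flip: not_le)

lemma realizes_eq:
  assumes "realizes H S z\<^sub>0 z" "a \<in> S" "b \<in> S" "z\<^sub>0 a = z\<^sub>0 b"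
  shows "z a = z b"
proof (rule antisym)
  show "z a \<le> z b" "z b \<le> z a" using assms by (simp_all add: realizes_def)
qed

text \<open>Only finitely many tuples have all entries at most \<open>v\<close>. This converts a
  bound on coordinates into the bound on codes that the elimination lemmas ask for.\<close>

lemma bounded_codes:
  fixes code :: "('a \<Rightarrow> nat) \<Rightarrow> nat"
  assumes "finite S"
  obtains bnd :: "nat \<Rightarrow> nat" where "\<And>v z. z \<in> S \<rightarrow>\<^sub>E {..v} \<Longrightarrow> code z \<le> bnd v"
proof -
  have "finite (code ` (S \<rightarrow>\<^sub>E {..v}))" for v :: nat
    using assms by (intro finite_imageI finite_PiE) auto
  then have "\<forall>v. \<exists>b. \<forall>z \<in> S \<rightarrow>\<^sub>E {..v::nat}. code z \<le> b"
    unfolding finite_nat_set_iff_bounded_le by blast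
  then show ?thesis using that by metis
qed

lemma injective_code:
  assumes "finite (S :: 'a set)"
  obtains code :: "('a \<Rightarrow> nat) \<Rightarrow> nat" where "inj_on code (S \<rightarrow>\<^sub>E UNIV)"
proof -
  obtain xs where xs: "set xs = S" using finite_list[OF assms] by blast
  show ?thesis
  proof (rule that, rule inj_onI)
    fix z z' assume "z \<in> S \<rightarrow>\<^sub>E UNIV" "z' \<in> S \<rightarrow>\<^sub>E UNIV"
      and "(\<lambda>z. list_encode (map z xs)) z = (\<lambda>z. list_encode (map z xs)) z'"
    then have "map z xs = map z' xs" by (metis list_encode_eq)
    then have "z a = z' a" if "a \<in> S" for a
      using that xs by (metis map_eq_conv)
    with \<open>z \<in> _\<close> \<open>z' \<in> _\<close> show "z = z'" by (rule PiE_ext)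
  qed
qed

context three_functions_ultrafilter
begin

text \<open>A realization is determined by its restriction to the symbols below the top class and the
  value of that class; the latter is so large that it cannot influence membership in \<open>C\<close>.\<close>

lemma homogeneous_for_type:
  assumes cons: "conservative_map fst W"
    and fin: "finite V"
    and parent: "\<And>i. Inr i \<in> V \<Longrightarrow> Inl i \<in> V \<and> z\<^sub>0 (Inl i) < z\<^sub>0 (Inr i)"
    and ties: "\<And>a b. \<lbrakk>a \<in> V; b \<in> V; a \<noteq> b; z\<^sub>0 a = z\<^sub>0 b\<rbrakk> \<Longrightarrow> isl a"
  shows "\<exists>H\<in>W. \<forall>z z'. realizes H {a\<in>V. z\<^sub>0 a < t} z\<^sub>0 z \<longrightarrow>
    realizes H {a\<in>V. z\<^sub>0 a < t} z\<^sub>0 z' \<longrightarrow> (z \<in> C \<longleftrightarrow> z' \<in> C)"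
\<comment> \<open>\<open>C\<close> varies because each step passes to a different set, of shorter
  tuples.\<close>
proof (induction t arbitrary: C)
  case 0
  have "UNIV \<in> W" using U by (simp add: ultrafilter_def)
  then show ?case by (intro bexI[of _ UNIV]) (auto simp: realizes_def)
next
  case (Suc t)
  define S where "S = {a\<in>V. z\<^sub>0 a < t}"
  define S' where "S' = {a\<in>V. z\<^sub>0 a < Suc t}"
  define E where "E = {a\<in>V. z\<^sub>0 a = t}"
  have S': "S' = S \<union> E" by (auto simp: S_def S'_def E_def)
  have finS: "finite S" using fin by (simp add: S_def)
  have S_closed: "Inl i \<in> S" if "Inr i \<in> S" for i
    using that parent[of i] by (auto simp: S_def)
  have IH: "\<exists>H\<in>W. \<forall>z z'. realizes H S z\<^sub>0 z \<longrightarrow> realizes H S z\<^sub>0 z' \<longrightarrow> (z \<in> C' \<longleftrightarrow> z' \<in> C')" for C'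
    using Suc.IH unfolding S_def .
  obtain code :: "(nat + nat \<Rightarrow> nat) \<Rightarrow> nat" where code: "inj_on code (S \<rightarrow>\<^sub>E UNIV)"
    using injective_code[OF finS] .
  obtain bnd where bnd: "\<And>v z. z \<in> S \<rightarrow>\<^sub>E {..v} \<Longrightarrow> code z \<le> bnd v"
    using bounded_codes[OF finS, of code] by blast
  have restr: "realizes H S z\<^sub>0 (restrict z S)" if "realizes H S' z\<^sub>0 z" for H z
    using realizes_restrict[OF that] S_closed S' by blast
  have large: "\<exists>H\<in>W. \<forall>z. realizes H S' z\<^sub>0 z \<longrightarrow>
      (\<exists>m. code (restrict z S) \<le> m \<and> (\<forall>a\<in>E. h m < z a))" for h :: "nat \<Rightarrow> nat"
  proof -
    obtain H where H: "H \<in> W"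
      "\<And>u v. \<lbrakk>u \<in> insert 0 (fst ` H \<union> snd ` H); v \<in> fst ` H \<union> snd ` H; u < v\<rbrakk> \<Longrightarrow> h (bnd u) < v"
      "\<And>v. v \<in> fst ` H \<union> snd ` H \<Longrightarrow> 0 < v"
      using sparse_set[of "\<lambda>v. h (bnd v)"] by metis
    have "\<exists>m. code (restrict z S) \<le> m \<and> (\<forall>a\<in>E. h m < z a)" if z: "realizes H S' z\<^sub>0 z" for z
    proof -
      \<comment> \<open>The next smaller coordinate, with default 0 when \<open>S\<close> is empty;
        hence the extra point 0 in \<open>sparse_set\<close>.\<close>
      define v where "v = Max (insert 0 (z ` S))"
      have v: "v \<in> insert 0 (z ` S)" "\<And>a. a \<in> S \<Longrightarrow> z a \<le> v"
        unfolding v_def using finS Max_in[of "insert 0 (z ` S)"] Max_ge[of "insert 0 (z ` S)"]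
        by auto
      have vH: "v \<in> insert 0 (fst ` H \<union> snd ` H)"
        using v(1) realizes_value[OF z] S' by auto
      have "h (bnd v) < z a" if a: "a \<in> E" for a
      proof (rule H(2)[OF vH])
        show za: "z a \<in> fst ` H \<union> snd ` H" using realizes_value[OF z] a S' by blast
        have "z b < z a" if "b \<in> S" for b
          using realizes_less[OF z, of b a] that a S' by (auto simp: S_def E_def)
        then show "v < z a" using v(1) H(3)[OF za] by auto
      qed
      moreover have "code (restrict z S) \<le> bnd v" using v(2) by (intro bnd) auto
      ultimately show ?thesis by blast
    qed
    then show ?thesis using H(1) by blast
  qed
  have conclude: "\<exists>H\<in>W. \<forall>z z'. realizes H S' z\<^sub>0 z \<longrightarrow> realizes H S' z\<^sub>0 z' \<longrightarrow> (z \<in> C \<longleftrightarrow> z' \<in> C)"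
    if H: "H \<in> W" "\<And>z. realizes H S' z\<^sub>0 z \<Longrightarrow> z \<in> C \<longleftrightarrow> restrict z S \<in> C'" for H C'
  proof -
    obtain H' where H': "H' \<in> W"
      "\<And>z z'. \<lbrakk>realizes H' S z\<^sub>0 z; realizes H' S z\<^sub>0 z'\<rbrakk> \<Longrightarrow> z \<in> C' \<longleftrightarrow> z' \<in> C'"
      using IH by metis
    show ?thesis
    proof (intro bexI[of _ "H \<inter> H'"] allI impI)
      show "H \<inter> H' \<in> W" using H(1) H'(1) by (rule Int)
      fix z z' assume z: "realizes (H \<inter> H') S' z\<^sub>0 z" and z': "realizes (H \<inter> H') S' z\<^sub>0 z'"
      have "realizes H S' z\<^sub>0 z" "realizes H S' z\<^sub>0 z'"
        and "realizes H' S z\<^sub>0 (restrict z S)" "realizes H' S z\<^sub>0 (restrict z' S)"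
        using z z' restr[OF z] restr[OF z'] by (auto elim!: realizes_mono)
      then show "z \<in> C \<longleftrightarrow> z' \<in> C" using H(2) H'(2) by metis
    qed
  qed
  \<comment> \<open>No symbol need have value \<open>t\<close>. Otherwise \<open>ties\<close> leaves
    two shapes for the top class: a single y, or x's only.\<close>
  consider "E = {}" | i where "Inr i \<in> E" | i where "Inl i \<in> E" "\<And>a. a \<in> E \<Longrightarrow> isl a"
    by (metis all_not_in_conv isl_def obj_sumE)
  then have "\<exists>H\<in>W. \<forall>z z'. realizes H S' z\<^sub>0 z \<longrightarrow> realizes H S' z\<^sub>0 z' \<longrightarrow> (z \<in> C \<longleftrightarrow> z' \<in> C)"
  proof cases
    case 1
    then show ?thesis using IH[of C] S' by simp
  next
    case (2 i)
    have "a = Inr i" if "a \<in> E" for a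
      using 2 ties[of "Inr i" a] that by (auto simp: E_def)
    then have E: "E = {Inr i}" using 2 by blast
    have i: "Inl i \<in> S" using 2 parent[of i] by (auto simp: E_def S_def)
    define A :: "nat \<times> nat \<Rightarrow> nat set"
      where "A p = {code z |z. z \<in> S \<rightarrow>\<^sub>E UNIV \<and> z(Inr i := snd p) \<in> C}" for p
    have "\<exists>H\<in>W. \<exists>h B. \<forall>p\<in>H. \<forall>m. h m < snd p \<longrightarrow> (\<forall>y\<le>m. y \<in> A p \<longleftrightarrow> y \<in> B (fst p))"
      by (rule eliminate_snd[OF cons, of A]) blast
    then obtain H1 h B where H1: "H1 \<in> W"
      "\<forall>p\<in>H1. \<forall>m. h m < snd p \<longrightarrow> (\<forall>y\<le>m. y \<in> A p \<longleftrightarrow> y \<in> B (fst p))"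
      by blast
    obtain H2 where H2: "H2 \<in> W" "\<And>z. realizes H2 S' z\<^sub>0 z \<Longrightarrow>
        \<exists>m. code (restrict z S) \<le> m \<and> (\<forall>a\<in>E. h m < z a)"
      using large[of h] by blast
    \<comment> \<open>Since x_i lies strictly below y_i, \<open>fst p\<close> can be read off the
      shorter tuple, and the indexed family \<open>B\<close> collapses to one set of such
      tuples.\<close>
    show ?thesis
    proof (rule conclude[of "H1 \<inter> H2" "{z. code z \<in> B (z (Inl i))}"])
      show "H1 \<inter> H2 \<in> W" using H1(1) H2(1) by (rule Int)
      fix z assume z: "realizes (H1 \<inter> H2) S' z\<^sub>0 z"
      define p where "p = (z (Inl i), z (Inr i))"
      have p: "p \<in> H1" using z S' E by (auto simp: realizes_def p_def)
      obtain m where m: "code (restrict z S) \<le> m" "h m < snd p"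
        using H2(2)[OF realizes_mono[OF z]] E by (auto simp: p_def)
      have z_eq: "z = (restrict z S)(Inr i := snd p)"
        using z S' E by (auto simp: realizes_def p_def fun_eq_iff PiE_def extensional_def)
      have "code (restrict z S) \<in> A p \<longleftrightarrow> (restrict z S)(Inr i := snd p) \<in> C"
        unfolding A_def using inj_onD[OF code, of "restrict z S"] by force
      then have "z \<in> C \<longleftrightarrow> code (restrict z S) \<in> B (fst p)"
        using H1(2) p m z_eq by simp
      then show "z \<in> C \<longleftrightarrow> restrict z S \<in> {z. code z \<in> B (z (Inl i))}"
        using i by (simp add: p_def)
    qed
  next
    case (3 i)
    define ext where "ext x z = (\<lambda>a. if a \<in> E then x else z a)" for x and z :: "nat + nat \<Rightarrow> nat"
    define A where "A x = {code z |z. z \<in> S \<rightarrow>\<^sub>E UNIV \<and> ext x z \<in> C}" for x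
    have "\<exists>H\<in>W. \<exists>h B. \<forall>p\<in>H. \<forall>m. h m < fst p \<longrightarrow> (\<forall>y\<le>m. y \<in> A (fst p) \<longleftrightarrow> y \<in> B)"
      by (rule eliminate_fst[of A]) blast
    then obtain H1 h B where H1: "H1 \<in> W"
      "\<forall>p\<in>H1. \<forall>m. h m < fst p \<longrightarrow> (\<forall>y\<le>m. y \<in> A (fst p) \<longleftrightarrow> y \<in> B)"
      by blast
    obtain H2 where H2: "H2 \<in> W" "\<And>z. realizes H2 S' z\<^sub>0 z \<Longrightarrow>
        \<exists>m. code (restrict z S) \<le> m \<and> (\<forall>a\<in>E. h m < z a)"
      using large[of h] by blast
    show ?thesis
    proof (rule conclude[of "H1 \<inter> H2" "{z. code z \<in> B}"])
      show "H1 \<inter> H2 \<in> W" using H1(1) H2(1) by (rule Int)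
      fix z assume z: "realizes (H1 \<inter> H2) S' z\<^sub>0 z"
      have "z (Inl i) \<in> fst ` (H1 \<inter> H2)"
        using z S' 3(1) by (simp add: realizes_def)
      \<comment> \<open>\<open>Inr i\<close> lies above the top class or outside \<open>V\<close>,
        so any point of \<open>H1\<close> with this first coordinate will do.\<close>
      then obtain p where p: "p \<in> H1" "fst p = z (Inl i)" by auto
      obtain m where m: "code (restrict z S) \<le> m" "h m < fst p"
        using H2(2)[OF realizes_mono[OF z]] 3(1) p(2) by auto
      have top: "z a = z (Inl i)" if "a \<in> E" for a
        using realizes_eq[OF z, of a "Inl i"] that 3(1) S' by (auto simp: E_def)
      have z_eq: "z = ext (fst p) (restrict z S)"
        using z S' top p(2) by (auto simp: ext_def realizes_def fun_eq_iff PiE_def extensional_def)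
      have "code (restrict z S) \<in> A (fst p) \<longleftrightarrow> ext (fst p) (restrict z S) \<in> C"
        unfolding A_def using inj_onD[OF code, of "restrict z S"] by force
      then show "z \<in> C \<longleftrightarrow> restrict z S \<in> {z. code z \<in> B}"
        using H1(2) p(1) m z_eq by simp
    qed
  qed
  then show ?case unfolding S'_def .
qed

end

section \<open>From n-subsets to n-types\<close>

lemma increasing_enumeration:
  assumes "A \<in> nsubsets UNIV n" "inj_on snd A"
  obtains z :: "nat + nat \<Rightarrow> nat" where "z \<in> type_symbols n \<rightarrow>\<^sub>E UNIV"
    "(\<lambda>i. (z (Inl i), z (Inr i))) ` {1..n} = A"
    "\<And>i j. \<lbrakk>1 \<le> i; i < j; j \<le> n\<rbrakk> \<Longrightarrow> z (Inr i) < z (Inr j)"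
proof -
  have A: "finite A" "card A = n" using assms(1) by (auto simp: nsubsets_def)
  define ys where "ys = sorted_list_of_set (snd ` A)"
  have ys: "length ys = n" "set ys = snd ` A" "sorted_wrt (<) ys"
    using A card_image[OF assms(2)] by (auto simp: ys_def)
  \<comment> \<open>Symbols are numbered from 1, list positions from 0.\<close>
  define p where "p i = inv_into A snd (ys ! (i - 1))" for i
  have snd_p: "snd (p i) = ys ! (i - 1)" if "1 \<le> i" "i \<le> n" for i
    unfolding p_def using that ys by (intro f_inv_into_f) (metis nth_mem less_le_trans diff_Suc_less Suc_le_eq One_nat_def)
  define z where "z = restrict (case_sum (fst \<circ> p) (snd \<circ> p)) (type_symbols n)"
  have z: "z (Inl i) = fst (p i)" "z (Inr i) = snd (p i)" if "1 \<le> i" "i \<le> n" for i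
    using that by (auto simp: z_def type_symbols_def)
  show ?thesis
  proof (rule that)
    show "z \<in> type_symbols n \<rightarrow>\<^sub>E UNIV" by (auto simp: z_def)
    have "(\<lambda>i. i - 1) ` {1..n} = {..<n}"
      by (auto simp: image_iff intro!: bexI[of _ "Suc _"])
    then have "(!) ys ` (\<lambda>i. i - 1) ` {1..n} = snd ` A"
      using ys(1,2) by (auto simp: set_conv_nth image_iff)
    then have nth: "(\<lambda>i. ys ! (i - 1)) ` {1..n} = snd ` A"
      by (simp only: image_image)
    have "(\<lambda>i. (z (Inl i), z (Inr i))) ` {1..n} = p ` {1..n}"
      by (rule image_cong) (auto simp: z)
    also have "\<dots> = inv_into A snd ` (\<lambda>i. ys ! (i - 1)) ` {1..n}"
      by (simp add: image_image p_def)
    also have "\<dots> = A"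
      unfolding nth using assms(2) by (simp add: inv_into_image_cancel)
    finally show "(\<lambda>i. (z (Inl i), z (Inr i))) ` {1..n} = A" .
    show "z (Inr i) < z (Inr j)" if "1 \<le> i" "i < j" "j \<le> n" for i j
      using that sorted_wrt_nth_less[OF ys(3), of "i - 1" "j - 1"] ys(1) by (simp add: z snd_p)
  qed
qed

lemma finite_type_symbols: "finite (type_symbols n)"
  by (simp add: type_symbols_def)

lemma finite_n_types: "finite (n_types n)"
  by (rule finite_subset[of _ "Pow (type_symbols n \<times> type_symbols n)"])
    (auto simp: n_types_def finite_type_symbols)

definition order_type :: "nat \<Rightarrow> (nat + nat \<Rightarrow> nat) \<Rightarrow> (nat + nat) rel" where
  "order_type n z = {(a, b). a \<in> type_symbols n \<and> b \<in> type_symbols n \<and> z a \<le> z b}"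

lemma order_type_in_n_types:
  assumes "\<And>i. i \<in> {1..n} \<Longrightarrow> z (Inl i) < z (Inr i)"
    and "\<And>i j. \<lbrakk>1 \<le> i; i < j; j \<le> n\<rbrakk> \<Longrightarrow> z (Inr i) < z (Inr j)"
    and "\<And>a b. \<lbrakk>a \<in> type_symbols n; b \<in> type_symbols n; a \<noteq> b; z a = z b\<rbrakk> \<Longrightarrow> isl a"
  shows "order_type n z \<in> n_types n"
proof -
  have "preorder_on (type_symbols n) (order_type n z)"
    by (auto simp: preorder_on_def refl_on_def trans_def order_type_def)
  moreover have "total_on (type_symbols n) (order_type n z)"
    by (auto simp: total_on_def order_type_def)
  moreover have "strictly_below (order_type n z) (Inr i) (Inr j)" if "1 \<le> i \<and> i < j \<and> j \<le> n" for i j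
    using assms(2)[of i j] that by (auto simp: strictly_below_def order_type_def type_symbols_def)
  moreover have "strictly_below (order_type n z) (Inl i) (Inr i)" if "1 \<le> i \<and> i \<le> n" for i
    using assms(1)[of i] that by (auto simp: strictly_below_def order_type_def type_symbols_def)
  moreover have "isl a \<and> isl b" if "a \<in> type_symbols n" "b \<in> type_symbols n"
    "a \<noteq> b \<and> (a, b) \<in> order_type n z \<and> (b, a) \<in> order_type n z" for a b
    using assms(3)[of a b] assms(3)[of b a] that by (auto simp: order_type_def)
  ultimately show ?thesis by (auto simp: n_types_def order_type_def)
qed

theorem mainTheorem8:
  fixes W :: "(nat \<times> nat) set set"
  assumes "non_P_point_std W"
    and "three_functions_property W"
    and "conservative_map fst W"
  shows "\<forall>n\<ge>1. weakly_Ramsey n (T n) W"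
proof (intro allI impI)
  fix n :: nat
  interpret three_functions_ultrafilter W
    using assms by unfold_locales
  \<comment> \<open>These separation properties make the increasing enumeration of any n-subset of
    \<open>H0\<close> realize an n-type, with ties among x's only.\<close>
  obtain H0 where H0: "H0 \<in> W" "inj_on snd H0" "\<And>p. p \<in> H0 \<Longrightarrow> fst p < snd p"
    "\<And>p q. \<lbrakk>p \<in> H0; q \<in> H0\<rbrakk> \<Longrightarrow> fst p \<noteq> snd q"
    using sparse_set[of id] by metis
  have "\<forall>A\<in>nsubsets H0 n. \<exists>z. z \<in> type_symbols n \<rightarrow>\<^sub>E UNIV \<and>
      (\<lambda>i. (z (Inl i), z (Inr i))) ` {1..n} = A \<and>
      (\<forall>i j. 1 \<le> i \<longrightarrow> i < j \<longrightarrow> j \<le> n \<longrightarrow> z (Inr i) < z (Inr j))"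
  proof
    fix A assume "A \<in> nsubsets H0 n"
    then have "A \<in> nsubsets UNIV n" "inj_on snd A"
      using inj_on_subset[OF H0(2)] by (auto simp: nsubsets_def)
    then obtain z where "z \<in> type_symbols n \<rightarrow>\<^sub>E UNIV"
      "(\<lambda>i. (z (Inl i), z (Inr i))) ` {1..n} = A"
      "\<And>i j. \<lbrakk>1 \<le> i; i < j; j \<le> n\<rbrakk> \<Longrightarrow> z (Inr i) < z (Inr j)"
      using increasing_enumeration by blast
    then show "\<exists>z. z \<in> type_symbols n \<rightarrow>\<^sub>E UNIV \<and>
      (\<lambda>i. (z (Inl i), z (Inr i))) ` {1..n} = A \<and>
      (\<forall>i j. 1 \<le> i \<longrightarrow> i < j \<longrightarrow> j \<le> n \<longrightarrow> z (Inr i) < z (Inr j))" by blast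
  qed
  from bchoice[OF this] obtain enum where "\<forall>A\<in>nsubsets H0 n.
      enum A \<in> type_symbols n \<rightarrow>\<^sub>E UNIV \<and>
      (\<lambda>i. (enum A (Inl i), enum A (Inr i))) ` {1..n} = A \<and>
      (\<forall>i j. 1 \<le> i \<longrightarrow> i < j \<longrightarrow> j \<le> n \<longrightarrow> enum A (Inr i) < enum A (Inr j))" ..
  then have enum: "\<And>A. A \<in> nsubsets H0 n \<Longrightarrow> enum A \<in> type_symbols n \<rightarrow>\<^sub>E UNIV"
    "\<And>A. A \<in> nsubsets H0 n \<Longrightarrow> (\<lambda>i. (enum A (Inl i), enum A (Inr i))) ` {1..n} = A"
    "\<And>A i j. \<lbrakk>A \<in> nsubsets H0 n; 1 \<le> i; i < j; j \<le> n\<rbrakk> \<Longrightarrow> enum A (Inr i) < enum A (Inr j)"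
    by simp_all
  have enum_mem: "(enum A (Inl i), enum A (Inr i)) \<in> A" if "A \<in> nsubsets H0 n" "i \<in> {1..n}" for A i
    using enum(2)[OF that(1)] that(2) by blast
  have enum_H0: "(enum A (Inl i), enum A (Inr i)) \<in> H0" if "A \<in> nsubsets H0 n" "i \<in> {1..n}" for A i
    using enum_mem[OF that] that(1) by (auto simp: nsubsets_def)
  have parent: "enum A (Inl i) < enum A (Inr i)" if "A \<in> nsubsets H0 n" "i \<in> {1..n}" for A i
    using H0(3)[OF enum_H0[OF that]] by simp
  have ties: "isl a" if A: "A \<in> nsubsets H0 n" and ab: "a \<in> type_symbols n" "b \<in> type_symbols n"
    "a \<noteq> b" "enum A a = enum A b" for A a b
  proof (rule ccontr)
    assume "\<not> isl a"
    then obtain i where a: "a = Inr i" by (cases a) auto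
    then have i: "i \<in> {1..n}" using ab by (auto simp: type_symbols_def)
    show False
    proof (cases b)
      case (Inl j)
      then have "j \<in> {1..n}" using ab by (auto simp: type_symbols_def)
      then show False using H0(4)[OF enum_H0[OF A] enum_H0[OF A i]] ab(4) a Inl by force
    next
      case (Inr j)
      then have "j \<in> {1..n}" "i < j \<or> j < i" using ab a by (auto simp: type_symbols_def)
      then show False using enum(3)[OF A, of i j] enum(3)[OF A, of j i] i ab(4) a Inr by auto
    qed
  qed
  have types: "order_type n (enum A) \<in> n_types n" if "A \<in> nsubsets H0 n" for A
    by (rule order_type_in_n_types) (use parent enum(3) ties that in blast)+
  have realizes_enum: "realizes H (type_symbols n) z\<^sub>0 (enum A)"
    if A: "A \<in> nsubsets H0 n" "A \<subseteq> H" and ty: "order_type n (enum A) = order_type n z\<^sub>0" for A H z\<^sub>0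
  proof -
    have order: "enum A a \<le> enum A b \<longleftrightarrow> z\<^sub>0 a \<le> z\<^sub>0 b"
      if "a \<in> type_symbols n" "b \<in> type_symbols n" for a b
      using arg_cong[OF ty, of "\<lambda>R. (a, b) \<in> R"] that by (simp add: order_type_def)
    have pair: "(enum A (Inl i), enum A (Inr i)) \<in> H" if "i \<in> {1..n}" for i
      using enum_mem[OF A(1) that] A(2) by blast
    have "i \<in> {1..n}" if "Inl i \<in> type_symbols n \<or> Inr i \<in> type_symbols n" for i
      using that by (auto simp: type_symbols_def)
    moreover have "Inl i \<in> type_symbols n" if "i \<in> {1..n}" for i
      using that by (simp add: type_symbols_def)
    ultimately show ?thesis
      unfolding realizes_def using enum(1)[OF A(1)] order pair by (metis fst_conv imageI)
  qed
  show "weakly_Ramsey n (T n) W"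
    unfolding weakly_Ramsey_def
  proof (intro allI impI)
    fix c :: "(nat \<times> nat) set \<Rightarrow> nat" and k :: nat
    assume c: "c ` nsubsets UNIV n \<subseteq> {..<k}"
    have "\<exists>H\<in>W. H \<subseteq> H0 \<and> (\<forall>A\<in>nsubsets H n. \<forall>A'\<in>nsubsets H n.
        order_type n (enum A) = R \<longrightarrow> order_type n (enum A') = R \<longrightarrow> c A = c A')" for R
    proof (cases "\<exists>A\<in>nsubsets H0 n. order_type n (enum A) = R")
      case False
      then show ?thesis using H0(1) by (intro bexI[of _ H0]) auto
    next
      case True
      then obtain A0 where A0: "A0 \<in> nsubsets H0 n" "order_type n (enum A0) = R" by blast
      \<comment> \<open>\<open>enum A0\<close> is the reference valuation; \<open>t\<close> lies
        above all its values, so no symbol is cut off.\<close>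
      obtain t where t: "\<And>a. a \<in> type_symbols n \<Longrightarrow> enum A0 a < t"
        using finite_imageI[OF finite_type_symbols, of "enum A0" n]
        unfolding finite_nat_set_iff_bounded by blast
      have V: "{a \<in> type_symbols n. enum A0 a < t} = type_symbols n" using t by blast
      have A0_parent: "Inl i \<in> type_symbols n \<and> enum A0 (Inl i) < enum A0 (Inr i)"
        if "Inr i \<in> type_symbols n" for i
        using parent[OF A0(1), of i] that by (auto simp: type_symbols_def)
      have "\<exists>H\<in>W. \<forall>z z'. realizes H (type_symbols n) (enum A0) z \<longrightarrow>
          realizes H (type_symbols n) (enum A0) z' \<longrightarrow> (z \<in> C \<longleftrightarrow> z' \<in> C)" for C
        using homogeneous_for_type[OF assms(3) finite_type_symbols A0_parent ties[OF A0(1)],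
            where t = t and C = C] unfolding V .
      then obtain F where F: "\<And>C. F C \<in> W"
        "\<And>C z z'. \<lbrakk>realizes (F C) (type_symbols n) (enum A0) z;
          realizes (F C) (type_symbols n) (enum A0) z'\<rbrakk> \<Longrightarrow> z \<in> C \<longleftrightarrow> z' \<in> C"
        by metis
      \<comment> \<open>\<open>homogeneous_for_type\<close> decides one set of valuations at a time,
        so it is applied to each colour class and the \<open>k\<close> resulting sets are
        intersected.\<close>
      define C where "C j = {z. c ((\<lambda>i. (z (Inl i), z (Inr i))) ` {1..n}) = j}" for j
      define H where "H = H0 \<inter> (\<Inter>j\<in>{..<k}. F (C j))"
      have HW: "H \<in> W" unfolding H_def
        by (rule Int[OF H0(1) ultrafilter_INT[OF U]]) (auto simp: F(1))
      have "c A = c A'" if A: "A \<in> nsubsets H n" "order_type n (enum A) = R"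
        and A': "A' \<in> nsubsets H n" "order_type n (enum A') = R" for A A'
      proof -
        have sub: "A \<in> nsubsets H0 n" "A' \<in> nsubsets H0 n" "A \<in> nsubsets UNIV n"
          using A A' by (auto simp: nsubsets_def H_def)
        then have "c A < k" using c by blast
        then have "A \<subseteq> F (C (c A))" "A' \<subseteq> F (C (c A))"
          using A(1) A'(1) by (auto simp: nsubsets_def H_def)
        then have "enum A \<in> C (c A) \<longleftrightarrow> enum A' \<in> C (c A)"
          using A(2) A'(2) A0(2) sub by (intro F(2) realizes_enum) auto
        then show ?thesis using enum(2) sub by (simp add: C_def)
      qed
      then have "\<forall>A\<in>nsubsets H n. \<forall>A'\<in>nsubsets H n.
          order_type n (enum A) = R \<longrightarrow> order_type n (enum A') = R \<longrightarrow> c A = c A'" by blast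
      moreover have "H \<subseteq> H0" unfolding H_def by blast
      ultimately show ?thesis using HW by blast
    qed
    then obtain G where G: "\<And>R. G R \<in> W" "\<And>R. G R \<subseteq> H0"
      "\<And>R A A'. \<lbrakk>A \<in> nsubsets (G R) n; A' \<in> nsubsets (G R) n; order_type n (enum A) = R;
        order_type n (enum A') = R\<rbrakk> \<Longrightarrow> c A = c A'"
      by metis
    define H where "H = H0 \<inter> (\<Inter>R\<in>n_types n. G R)"
    have HW: "H \<in> W" unfolding H_def
      by (rule Int[OF H0(1) ultrafilter_INT[OF U finite_n_types]]) (auto simp: G(1))
    \<comment> \<open>The common colour of the n-subsets of \<open>H\<close> with type
      \<open>R\<close>; arbitrary if there are none, which is harmless as only an inclusion of the
      colours in the image of \<open>d\<close> is used.\<close>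
    define d where "d R = c (SOME A. A \<in> nsubsets H n \<and> order_type n (enum A) = R)" for R
    have "c A = d (order_type n (enum A))" if A: "A \<in> nsubsets H n" for A
    proof -
      let ?R = "order_type n (enum A)"
      define A' where "A' = (SOME A. A \<in> nsubsets H n \<and> order_type n (enum A) = ?R)"
      have A': "A' \<in> nsubsets H n \<and> order_type n (enum A') = ?R"
        unfolding A'_def by (rule someI[of _ A]) (simp add: A)
      have "?R \<in> n_types n" using A by (intro types) (auto simp: nsubsets_def H_def)
      then have "nsubsets H n \<subseteq> nsubsets (G ?R) n" by (auto simp: nsubsets_def H_def)
      then have "c A = c A'" using A A' by (intro G(3)[of A ?R]) auto
      then show ?thesis by (simp add: d_def A'_def)
    qed
    then have "c ` nsubsets H n \<subseteq> d ` n_types n"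
      using types by (force simp: nsubsets_def H_def)
    then have "card (c ` nsubsets H n) \<le> T n"
      unfolding T_def using finite_n_types
      by (meson card_image_le card_mono finite_imageI le_trans)
    with HW show "\<exists>H\<in>W. card (c ` nsubsets H n) \<le> T n" by blast
  qed
qed

end
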